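(* Let $\pi$ and $\hat\pi$ be probability densities of (absolutely continuous) probability measures on $\mathcal{X}=\mathbb{R}^n$ with $R(\pi\|\hat\pi)<\infty$, let $\mathcal{S}\subseteq\mathbb{R}^n$ be a Borel set, and let $\lambda>0$. Then $$\mathbb{P}_{\boldsymbol{x}\sim\pi}[\boldsymbol{x}\notin\mathcal{S}]\;\le\;\frac1\lambda\Big\{\ln\Big(\mathbb{E}_{\hat\pi}\big[e^{\lambda(1-\mathbf{1}_{\{\boldsymbol{x}\in\mathcal{S}\}})}\big]\Big)+R(\pi\|\hat\pi)\Big\}\;=\;1+\frac1\lambda\Big\{\ln\Big(1-(1-e^{-\lambda})\,\mathbb{P}_{\boldsymbol{x}\sim\hat\pi}[\boldsymbol{x}\in\mathcal{S}]\Big)+R(\pi\|\hat\pi)\Big\}.$$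
   Context: The relative entropy (Kullback-Leibler divergence) is $R(\pi\|\hat\pi)=\int_{\mathcal{X}}\pi\ln(\pi/\hat\pi)\,d\boldsymbol{x}$ (equal to $+\infty$ if the measure with density $\pi$ is not absolutely continuous with respect to the one with density $\hat\pi$). $\mathbf{1}_{\{\cdot\}}$ is the indicator function and $\mathbb{E}_{\hat\pi}$ is expectation when $\boldsymbol{x}$ has density $\hat\pi$. Here $\pi$ is the true (unknown) state density at a fixed time, $\hat\pi$ is a reference density at that time, and $\mathcal{S}$ is the set of acceptable states. *)

theory Defs
  imports "HOL-Probability.Probability"
begin

definition prob_density :: "('a::euclidean_space \<Rightarrow> real) \<Rightarrow> bool" where
  "prob_density p \<longleftrightarrow>
     p \<in> borel_measurable borel \<and> (\<forall>x. 0 \<le> p x) \<and> prob_space (density lborel (\<lambda>x. ennreal (p x)))"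

text \<open>
  The integral of \<open>p ln (p / q)\<close> is the integral of the positive part minus that of the
  negative part, so it can be \<open>\<infinity>\<close>. Under absolute continuity the negative part has a
  finite integral, because \<open>p ln (p / q) \<ge> p - q\<close> almost everywhere, and \<open>p > 0 = q\<close> holds
  only on a null set, so the value given there by \<open>x / 0 = 0\<close> is immaterial. Where \<open>p = 0\<close>
  the integrand is \<open>0\<close>.
\<close>

definition rel_entropy ::
    "('a::euclidean_space \<Rightarrow> real) \<Rightarrow> ('a \<Rightarrow> real) \<Rightarrow> ereal" where
  "rel_entropy p q =
     (if absolutely_continuous (density lborel (\<lambda>x. ennreal (q x))) (density lborel (\<lambda>x. ennreal (p x)))
      then enn2ereal (\<integral>\<^sup>+ x. ennreal (p x * ln (p x / q x)) \<partial>lborel)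
         - enn2ereal (\<integral>\<^sup>+ x. ennreal (- (p x * ln (p x / q x))) \<partial>lborel)
      else \<infinity>)"

text \<open>
  The library's \<open>KL_divergence\<close> is real-valued, with value \<open>0\<close> for a non-integrable integrand,
  so it cannot express finiteness; the two notions agree whenever \<open>rel_entropy\<close> is finite.
\<close>

lemma rel_entropy_eq_KL_divergence:
  fixes p q :: "'a::euclidean_space \<Rightarrow> real"
  assumes p: "prob_density p" and q: "prob_density q" and fin: "rel_entropy p q < \<infinity>"
  shows "integrable lborel (\<lambda>x. p x * ln (p x / q x))"
    and "rel_entropy p q = ereal (KL_divergence (exp 1) (density lborel q) (density lborel p))"
proof -
  let ?f = "\<lambda>x. p x * ln (p x / q x)"
  have [measurable]: "p \<in> borel_measurable borel" "q \<in> borel_measurable borel"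
    and p0: "\<And>x. 0 \<le> p x" and q0: "\<And>x. 0 \<le> q x"
    using p q by (auto simp: prob_density_def)
  have ac: "absolutely_continuous (density lborel q) (density lborel p)"
    using fin by (auto simp: rel_entropy_def split: if_splits)
  have "{x. q x = 0} \<in> null_sets (density lborel q)"
    by (subst null_sets_density_iff) auto
  with ac have "{x. q x = 0} \<in> null_sets (density lborel p)"
    by (auto simp: absolutely_continuous_def)
  hence "AE x in lborel. x \<in> {x. q x = 0} \<longrightarrow> ennreal (p x) = 0"
    by (subst (asm) null_sets_density_iff) auto
  hence ae: "AE x in lborel. q x = 0 \<longrightarrow> p x = 0"
    by eventually_elim (use p0 in \<open>auto simp: ennreal_eq_0_iff intro: antisym\<close>)
  have "AE x in lborel. - ?f x \<le> q x"
    using ae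
  proof eventually_elim
    case (elim x)
    show ?case
    proof (cases "p x = 0")
      case False
      hence "p x > 0" "q x > 0" using elim p0[of x] q0[of x] by auto
      hence "- ln (p x / q x) = ln (q x / p x)" by (simp add: ln_div)
      also have "\<dots> \<le> q x / p x"
        using ln_le_minus_one[of "q x / p x"] \<open>p x > 0\<close> \<open>q x > 0\<close> by simp
      finally have "p x * (- ln (p x / q x)) \<le> p x * (q x / p x)"
        using \<open>p x > 0\<close> by (intro mult_left_mono) auto
      thus ?thesis using \<open>p x > 0\<close> by simp
    qed (use q0 in auto)
  qed
  hence "AE x in lborel. ennreal (- ?f x) \<le> ennreal (q x)"
    by eventually_elim (rule ennreal_leI)
  hence "(\<integral>\<^sup>+ x. ennreal (- ?f x) \<partial>lborel) \<le> (\<integral>\<^sup>+ x. ennreal (q x) \<partial>lborel)"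
    by (rule nn_integral_mono_AE)
  also have "\<dots> = emeasure (density lborel q) (space (density lborel q))"
    by (simp add: emeasure_density)
  also have "\<dots> = 1"
    using q by (intro prob_space.emeasure_space_1) (simp add: prob_density_def)
  finally have neg: "(\<integral>\<^sup>+ x. ennreal (- ?f x) \<partial>lborel) < \<infinity>"
    by (auto simp: less_top[symmetric] top_unique)
  have eq: "rel_entropy p q = enn2ereal (\<integral>\<^sup>+ x. ennreal (?f x) \<partial>lborel)
      - enn2ereal (\<integral>\<^sup>+ x. ennreal (- ?f x) \<partial>lborel)"
    using ac by (simp add: rel_entropy_def)
  have pos: "(\<integral>\<^sup>+ x. ennreal (?f x) \<partial>lborel) < \<infinity>"
    using fin unfolding eq by (auto simp: less_top[symmetric])
  show int: "integrable lborel ?f"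
    using neg pos by (subst real_integrable_def) auto
  have "rel_entropy p q = ereal (integral\<^sup>L lborel ?f)"
    unfolding eq real_lebesgue_integral_def[OF int] using neg pos
    by (cases "\<integral>\<^sup>+ x. ennreal (?f x) \<partial>lborel"; cases "\<integral>\<^sup>+ x. ennreal (- ?f x) \<partial>lborel")
       (auto simp: enn2ereal_ennreal)
  also have "integral\<^sup>L lborel ?f = (\<integral>x. p x * log (exp 1) (p x / q x) \<partial>lborel)"
    by (simp add: log_def)
  also have "\<dots> = KL_divergence (exp 1) (density lborel q) (density lborel p)"
    using ae p0 q0 by (subst lborel.KL_density_density) auto
  finally show "rel_entropy p q =
    ereal (KL_divergence (exp 1) (density lborel q) (density lborel p))" .
qed

end

theory Submission
  imports Defs
begin

text \<open>
  The inequality is an instance of the Donsker--Varadhan (Gibbs) variational inequality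
  \<open>E\<^sub>p[f] \<le> ln E\<^sub>q[exp f] + R(p \<parallel> q)\<close> (\<open>donsker_varadhan\<close>), at
  \<open>f = l (1 - 1\<^sub>S)\<close>: then \<open>E\<^sub>p[f]\<close> is \<open>l\<close> times the probability of leaving \<open>S\<close>.

  With \<open>c = ln E\<^sub>q[exp f]\<close>, the function \<open>g = q exp (f - c)\<close> is the exponential tilting of \<open>q\<close>;
  it is again a probability density. The variational inequality says that the relative entropy
  of \<open>p\<close> with respect to \<open>g\<close>, which is \<open>R(p \<parallel> q) - E\<^sub>p[f] + c\<close>, is nonnegative, and this follows by
  integrating \<open>p ln (g / p) \<le> g - p\<close>, since \<open>g\<close> and \<open>p\<close> have the same total mass.

  The equality holds because \<open>exp f\<close> takes only the values \<open>1\<close> on \<open>S\<close> and \<open>exp l\<close> off \<open>S\<close>, so that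
  its expectation is \<open>exp l\<close> times \<open>1 - (1 - exp (-l)) P\<^sub>q[S]\<close>, and the factor \<open>exp l\<close> contributes the
  summand \<open>1\<close> after the logarithm and the division by \<open>l\<close>.
\<close>

lemma AE_zero_of_absolutely_continuous:
  fixes p q :: "'a::euclidean_space \<Rightarrow> real"
  assumes p: "prob_density p" and q: "prob_density q"
    and ac: "absolutely_continuous (density lborel (\<lambda>x. ennreal (q x)))
               (density lborel (\<lambda>x. ennreal (p x)))"
  shows "AE x in lborel. q x = 0 \<longrightarrow> p x = 0"
proof -
  have [measurable]: "p \<in> borel_measurable borel" "q \<in> borel_measurable borel"
    and p0: "\<And>x. 0 \<le> p x"
    using p q by (auto simp: prob_density_def)
  have "{x. q x = 0} \<in> null_sets (density lborel q)"
    by (subst null_sets_density_iff) auto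
  with ac have "{x. q x = 0} \<in> null_sets (density lborel p)"
    by (auto simp: absolutely_continuous_def)
  hence "AE x in lborel. x \<in> {x. q x = 0} \<longrightarrow> ennreal (p x) = 0"
    by (subst (asm) null_sets_density_iff) auto
  thus ?thesis
    by eventually_elim (use p0 in \<open>auto simp: ennreal_eq_0_iff intro: antisym\<close>)
qed

lemma prob_density_lborel_integral:
  fixes p :: "'a::euclidean_space \<Rightarrow> real"
  assumes "prob_density p"
  shows "integrable lborel p" and "integral\<^sup>L lborel p = 1"
proof -
  interpret P: prob_space "density lborel (\<lambda>x. ennreal (p x))"
    using assms by (simp add: prob_density_def)
  have [measurable]: "p \<in> borel_measurable borel" and p0: "\<And>x. 0 \<le> p x"
    using assms by (auto simp: prob_density_def)
  have "integrable (density lborel (\<lambda>x. ennreal (p x))) (\<lambda>_. 1::real)"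
    by simp
  thus "integrable lborel p"
    by (subst (asm) integrable_density) (use p0 in auto)
  have "(\<integral>x. 1 \<partial>density lborel (\<lambda>x. ennreal (p x))) = (1::real)"
    using P.prob_space by simp
  thus "integral\<^sup>L lborel p = 1"
    by (subst (asm) integral_density) (use p0 in auto)
qed

lemma rel_entropy_eq_lborel_integral:
  fixes p q :: "'a::euclidean_space \<Rightarrow> real"
  assumes p: "prob_density p" and q: "prob_density q" and fin: "rel_entropy p q < \<infinity>"
  shows "rel_entropy p q = ereal (\<integral>x. p x * ln (p x / q x) \<partial>lborel)"
proof -
  have meas: "p \<in> borel_measurable borel" "q \<in> borel_measurable borel"
    "\<And>x. 0 \<le> p x" "\<And>x. 0 \<le> q x"
    using p q by (auto simp: prob_density_def)
  have "AE x in lborel. q x = 0 \<longrightarrow> p x = 0"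
    using fin by (intro AE_zero_of_absolutely_continuous p q)
      (auto simp: rel_entropy_def split: if_splits)
  hence "KL_divergence (exp 1) (density lborel q) (density lborel p)
      = (\<integral>x. p x * log (exp 1) (p x / q x) \<partial>lborel)"
    using meas by (subst lborel.KL_density_density) auto
  thus ?thesis
    using rel_entropy_eq_KL_divergence(2)[OF p q fin] by (simp add: log_def)
qed

text \<open>
  The pointwise form of Gibbs' inequality, from \<open>ln t \<le> t - 1\<close> at \<open>t = b exp y / a\<close>.
\<close>

lemma gibbs_pointwise:
  fixes a b y :: real
  assumes "0 \<le> a" "0 \<le> b" "b = 0 \<longrightarrow> a = 0"
  shows "a * y - a * ln (a / b) \<le> b * exp y - a"
proof (cases "a = 0")
  case True
  thus ?thesis using assms by simp
next
  case False
  hence ab: "a > 0" "b > 0" using assms by auto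
  have "y - ln (a / b) = ln (b * exp y / a)"
    using ab by (simp add: ln_div ln_mult)
  also have "\<dots> \<le> b * exp y / a - 1"
    using ab by (intro ln_le_minus_one) simp
  finally have "a * (y - ln (a / b)) \<le> a * (b * exp y / a - 1)"
    using ab by (intro mult_left_mono) auto
  thus ?thesis using ab by (simp add: algebra_simps)
qed

text \<open>
  Integrating the pointwise bound at \<open>y = f x - c\<close> gives
  \<open>E\<^sub>p[f] - c - R(p \<parallel> q) \<le> exp (-c) E\<^sub>q[exp f] - 1\<close> for every real \<open>c\<close>; the choice
  \<open>c = ln E\<^sub>q[exp f]\<close> makes the right-hand side vanish.
\<close>

theorem donsker_varadhan:
  fixes p q f :: "'a::euclidean_space \<Rightarrow> real"
  assumes p: "prob_density p" and q: "prob_density q" and fin: "rel_entropy p q < \<infinity>"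
    and f_int: "integrable (density lborel (\<lambda>x. ennreal (p x))) f"
    and exp_int: "integrable (density lborel (\<lambda>x. ennreal (q x))) (\<lambda>x. exp (f x))"
  shows "ereal (\<integral>x. f x \<partial>density lborel (\<lambda>x. ennreal (p x)))
    \<le> ereal (ln (\<integral>x. exp (f x) \<partial>density lborel (\<lambda>x. ennreal (q x)))) + rel_entropy p q"
proof -
  let ?P = "density lborel (\<lambda>x. ennreal (p x))" and ?Q = "density lborel (\<lambda>x. ennreal (q x))"
  interpret Q: prob_space ?Q using q by (simp add: prob_density_def)
  have [measurable]: "p \<in> borel_measurable borel" "q \<in> borel_measurable borel"
    and p0: "\<And>x. 0 \<le> p x" and q0: "\<And>x. 0 \<le> q x"
    using p q by (auto simp: prob_density_def)
  have [measurable]: "f \<in> borel_measurable borel"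
    using borel_measurable_integrable[OF f_int] by simp
  define Z where "Z = (\<integral>x. exp (f x) \<partial>?Q)"
  have Z_pos: "Z > 0"
    unfolding Z_def using exp_int by (intro Q.expectation_greater) auto
  have pf: "integrable lborel (\<lambda>x. p x * f x)"
      "(\<integral>x. f x \<partial>?P) = (\<integral>x. p x * f x \<partial>lborel)"
    using f_int p0 by (auto simp: integrable_density integral_density)
  have qe: "integrable lborel (\<lambda>x. q x * exp (f x))"
      "Z = (\<integral>x. q x * exp (f x) \<partial>lborel)"
    using exp_int q0 by (auto simp: Z_def integrable_density integral_density)
  note ent_int = rel_entropy_eq_KL_divergence(1)[OF p q fin]
  note p_int = prob_density_lborel_integral[OF p]
  have ae: "AE x in lborel. q x = 0 \<longrightarrow> p x = 0"
    using fin by (intro AE_zero_of_absolutely_continuous p q)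
      (auto simp: rel_entropy_def split: if_splits)
  have "(\<integral>x. p x * f x - ln Z * p x - p x * ln (p x / q x) \<partial>lborel)
      \<le> (\<integral>x. q x * exp (f x) / Z - p x \<partial>lborel)"
  proof (rule integral_mono_AE)
    show "AE x in lborel. p x * f x - ln Z * p x - p x * ln (p x / q x)
        \<le> q x * exp (f x) / Z - p x"
      using ae
    proof eventually_elim
      case (elim x)
      have "p x * (f x - ln Z) - p x * ln (p x / q x) \<le> q x * exp (f x - ln Z) - p x"
        using elim p0 q0 by (intro gibbs_pointwise) auto
      thus ?case using Z_pos by (simp add: exp_diff algebra_simps)
    qed
  qed (use pf qe ent_int p_int in auto)
  also have "\<dots> = 0"
    using qe p_int Z_pos by simp
  finally have "(\<integral>x. f x \<partial>?P) \<le> ln Z + (\<integral>x. p x * ln (p x / q x) \<partial>lborel)"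
    using pf ent_int p_int by simp
  thus ?thesis
    unfolding rel_entropy_eq_lborel_integral[OF p q fin] Z_def by simp
qed

lemma (in prob_space) expectation_exp_indicator_compl:
  fixes l :: real
  assumes S: "S \<in> events"
  shows "expectation (\<lambda>x. exp (l * (1 - indicator S x))) = exp l * (1 - (1 - exp (- l)) * prob S)"
proof -
  have eq: "exp (l * (1 - indicator S x)) = exp l - (exp l - 1) * indicator S x" for x
    by (auto simp: indicator_def)
  have "integrable M (indicator S :: _ \<Rightarrow> real)"
    using S by (intro integrable_real_indicator) (auto simp: emeasure_eq_measure)
  moreover have "S \<inter> space M = S"
    using sets.sets_into_space[OF S] by auto
  ultimately have "expectation (\<lambda>x. exp (l * (1 - indicator S x))) = exp l - (exp l - 1) * prob S"
    unfolding eq by (simp add: prob_space)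
  also have "\<dots> = exp l * (1 - (1 - exp (- l)) * prob S)"
    by (simp add: algebra_simps flip: exp_add)
  finally show ?thesis .
qed

theorem mainTheorem1:
  fixes p q :: "real ^ 'n \<Rightarrow> real"
    and S :: "(real ^ 'n) set"
    and l :: real
  assumes "prob_density p"
    and "prob_density q"
    and "rel_entropy p q < \<infinity>"
    and "S \<in> sets borel"
    and "l > 0"
  shows "ereal (measure (density lborel (\<lambda>x. ennreal (p x))) {x. x \<notin> S})
      \<le> ereal (1 / l) *
          (ereal (ln (\<integral>x. exp (l * (1 - indicator S x)) \<partial>density lborel (\<lambda>x. ennreal (q x))))
           + rel_entropy p q)
    \<and> ereal (1 / l) *
          (ereal (ln (\<integral>x. exp (l * (1 - indicator S x)) \<partial>density lborel (\<lambda>x. ennreal (q x))))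
           + rel_entropy p q)
      = 1 + ereal (1 / l) *
          (ereal (ln (1 - (1 - exp (- l)) * measure (density lborel (\<lambda>x. ennreal (q x))) S))
           + rel_entropy p q)"
proof -
  let ?P = "density lborel (\<lambda>x. ennreal (p x))" and ?Q = "density lborel (\<lambda>x. ennreal (q x))"
  let ?f = "\<lambda>x. l * (1 - indicator S x) :: real"
  interpret P: prob_space ?P using assms by (simp add: prob_density_def)
  interpret Q: prob_space ?Q using assms by (simp add: prob_density_def)
  note [measurable] = \<open>S \<in> sets borel\<close>
  obtain R where R: "rel_entropy p q = ereal R"
    using rel_entropy_eq_lborel_integral[OF assms(1-3)] by blast
  have "integrable ?P ?f"
    using \<open>l > 0\<close> by (intro P.integrable_const_bound[of _ l]) (auto simp: indicator_def)
  moreover have "integrable ?Q (\<lambda>x. exp (?f x))"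
    using \<open>l > 0\<close> by (intro Q.integrable_const_bound[of _ "exp l"]) (auto simp: indicator_def)
  ultimately have "ereal (\<integral>x. ?f x \<partial>?P) \<le> ereal (ln (\<integral>x. exp (?f x) \<partial>?Q)) + rel_entropy p q"
    by (intro donsker_varadhan assms)
  moreover have "(\<integral>x. ?f x \<partial>?P) = l * measure ?P {x. x \<notin> S}"
  proof -
    have "?f = (\<lambda>x. l * indicator {x. x \<notin> S} x)"
      by (auto simp: indicator_def)
    thus ?thesis by simp
  qed
  ultimately have "l * measure ?P {x. x \<notin> S} \<le> ln (\<integral>x. exp (?f x) \<partial>?Q) + R"
    by (simp only: R plus_ereal.simps ereal_less_eq)
  hence ineq: "measure ?P {x. x \<notin> S} \<le> 1 / l * (ln (\<integral>x. exp (?f x) \<partial>?Q) + R)"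
    using \<open>l > 0\<close> by (simp add: field_simps)
  let ?D = "1 - (1 - exp (- l)) * measure ?Q S"
  have "(1 - exp (- l)) * measure ?Q S \<le> 1 - exp (- l)"
    using \<open>l > 0\<close> by (intro mult_left_le) auto
  also have "\<dots> < 1"
    by simp
  finally have D: "?D > 0"
    by simp
  have "(\<integral>x. exp (?f x) \<partial>?Q) = exp l * ?D"
    by (intro Q.expectation_exp_indicator_compl) simp
  hence "ln (\<integral>x. exp (?f x) \<partial>?Q) = l + ln ?D"
    using D by (simp add: ln_mult)
  hence "1 / l * (ln (\<integral>x. exp (?f x) \<partial>?Q) + R) = 1 + 1 / l * (ln ?D + R)"
    using \<open>l > 0\<close> by (simp add: field_simps)
  with ineq show ?thesis
    by (simp only: R plus_ereal.simps times_ereal.simps one_ereal_def ereal_less_eq ereal.inject)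
qed

end
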